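(* Let $d\ge 1$ be an integer, and consider inhomogeneous non-oriented Bernoulli bond percolation on $\mathbb{Z}^d$ and on $\mathbb{Z}^{d+1}$. Let $p_1,\dots,p_{d+1}\in[0,1)$ and let $\tilde p_d\in[0,1)$ be such that $1-\tilde p_d=(1-p_d)(1-p_{d+1})$. Then $$\theta_{d+1}(p_1,\dots,p_d,p_{d+1})\ \ge\ \theta_d(p_1,\dots,p_{d-1},\tilde p_d).$$
   Context: Inhomogeneous non-oriented Bernoulli bond percolation on $\mathbb{Z}^d$ with parameters $p_1,\dots,p_d\in[0,1]$: let $e_1,\dots,e_d$ be the canonical vectors of $\mathbb{Z}^d$. For each $i=1,\dots,d$ let $E_i=\{\langle x,x\pm e_i\rangle: x\in\mathbb{Z}^d\}$ be the set of (undirected) nearest-neighbour edges parallel to $e_i$, and let $E(\mathbb{Z}^d)=\bigcup_{i}E_i$. Let $\{X_e\}_{e\in E(\mathbb{Z}^d)}$ be independent random variables such that $X_e$ has Bernoulli($p_i$) distribution whenever $e\in E_i$, and let $\mathbb{P}$ be the resulting product measure. An edge $e$ is open if $X_e=1$ and closed otherwise. For $x,y\in\mathbb{Z}^d$, write $x\leftrightarrow y$ if there are $x_0=x,x_1,\dots,x_n=y$ (with $n\ge 0$) such that each $\langle x_{j-1},x_j\rangle$ belongs to $E(\mathbb{Z}^d)$ and is open, $j=1,\dots,n$. The open cluster of the origin is $\mathcal{C}^d_0=\{x\in\mathbb{Z}^d: 0\leftrightarrow x\}$, with size $|\mathcal{C}^d_0|$, and $\theta_d(p_1,\dots,p_d):=\mathbb{P}(|\mathcal{C}^d_0|=\infty)$.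 *)

theory Defs
  imports "HOL-Probability.Probability"
begin

text \<open>
  So that the dimension can be an ordinary natural number, \<open>\<int>\<^sup>d\<close> is represented by the functions
  \<open>nat \<Rightarrow> int\<close> whose coordinates outside \<open>{1..d}\<close> vanish. An undirected edge is a two-element set
  of vertices.
\<close>

type_synonym vertex = "nat \<Rightarrow> int"
type_synonym edge = "vertex set"

definition lattice :: "nat \<Rightarrow> vertex set" where
  "lattice d = {x. \<forall>i. i \<notin> {1..d} \<longrightarrow> x i = 0}"

definition origin :: vertex where
  "origin = (\<lambda>_. 0)"

definition edges_along :: "nat \<Rightarrow> nat \<Rightarrow> edge set" where
  "edges_along d i =
     {{x, y} | x y. x \<in> lattice d \<and> (y = x(i := x i + 1) \<or> y = x(i := x i - 1))}"

definition edges :: "nat \<Rightarrow> edge set" where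
  "edges d = (\<Union>i\<in>{1..d}. edges_along d i)"

definition direction :: "nat \<Rightarrow> edge \<Rightarrow> nat" where
  "direction d e = (THE i. i \<in> {1..d} \<and> e \<in> edges_along d i)"

lemma edges_along_differ:
  assumes "e \<in> edges_along d i"
  shows "(\<exists>x\<in>e. \<exists>y\<in>e. x j \<noteq> y j) \<longleftrightarrow> j = i"
  using assms by (auto simp: edges_along_def split: if_splits)

lemma direction_eq:
  assumes "i \<in> {1..d}" "e \<in> edges_along d i"
  shows "direction d e = i"
  unfolding direction_def using assms edges_along_differ by (intro the_equality) blast+

text \<open>
  A configuration assigns \<open>True\<close> to open and \<open>False\<close> to closed edges. Only \<open>p 1, \<dots>, p d\<close> matter
  in dimension \<open>d\<close>.
\<close>

definition percolation :: "nat \<Rightarrow> (nat \<Rightarrow> real) \<Rightarrow> (edge \<Rightarrow> bool) measure" where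
  "percolation d p =
     (\<Pi>\<^sub>M e\<in>edges d. measure_pmf (bernoulli_pmf (p (direction d e))))"

definition connected_by_open :: "nat \<Rightarrow> (edge \<Rightarrow> bool) \<Rightarrow> vertex \<Rightarrow> vertex \<Rightarrow> bool" where
  "connected_by_open d \<omega> x y \<longleftrightarrow>
     (\<exists>(n::nat) z. z 0 = x \<and> z n = y \<and>
        (\<forall>j\<in>{1..n}. {z (j - 1), z j} \<in> edges d \<and> \<omega> {z (j - 1), z j}))"

definition open_cluster :: "nat \<Rightarrow> (edge \<Rightarrow> bool) \<Rightarrow> vertex set" where
  "open_cluster d \<omega> = {x \<in> lattice d. connected_by_open d \<omega> origin x}"

definition theta :: "nat \<Rightarrow> (nat \<Rightarrow> real) \<Rightarrow> real" where
  "theta d p =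
     measure (percolation d p) {\<omega> \<in> space (percolation d p). infinite (open_cluster d \<omega>)}"

end

theory Submission
  imports Defs
begin

text \<open>
  The map \<open>\<pi>\<close> that replaces the coordinates \<open>x\<^sub>d, x\<^sub>d\<^sub>+\<^sub>1\<close> by their sum projects \<open>\<int>\<^sup>d\<^sup>+\<^sup>1\<close> onto \<open>\<int>\<^sup>d\<close>.
  At every lift of \<open>x\<close>, an edge \<open>{x, y}\<close> of \<open>\<int>\<^sup>d\<close> has one lift, or two when it is parallel to \<open>e\<^sub>d\<close>,
  and at least one of its lifts is open with exactly the probability that \<open>{x, y}\<close> is open.
  Explore the cluster of a finite set \<open>A\<close> along finitely many edges \<open>F\<close>, and in parallel the cluster
  of a set \<open>B\<close> containing one lift of each point of \<open>A\<close>, along the lifts of \<open>F\<close>. Revealing a boundary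
  edge \<open>{x, y}\<close> of \<open>A\<close> either adds \<open>y\<close> to \<open>A\<close> or deletes the edge from \<open>F\<close>; upstairs, revealing
  its lifts does the same with at least the same probability. Since the lifts of different edges are
  different, nothing is revealed twice, and induction on \<open>F\<close> shows that the cluster upstairs is
  stochastically at least as large.
\<close>

section \<open>Clusters\<close>

text \<open>The start is a set and the edge set is arbitrary, so that exploration can enlarge the
  former and shrink the latter. As \<open>{u, v} = {v, u}\<close>, the relation is
  symmetric.\<close>

definition cluster :: "'v set set \<Rightarrow> 'v set \<Rightarrow> 'v set" where
  "cluster E A = {(u, v). {u, v} \<in> E}\<^sup>* `` A"

text \<open>Testing size by finite subsets makes infinite sets large for every \<open>n\<close>,
  whereas \<open>card\<close> would give them 0.\<close>

definition at_least :: "nat \<Rightarrow> 'v set \<Rightarrow> bool" where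
  "at_least n S \<longleftrightarrow> (\<exists>T\<subseteq>S. finite T \<and> card T = n)"

lemma at_least_mono: "at_least n S \<Longrightarrow> S \<subseteq> T \<Longrightarrow> at_least n T"
  unfolding at_least_def by blast

lemma at_least_antimono: "at_least m S \<Longrightarrow> n \<le> m \<Longrightarrow> at_least n S"
  unfolding at_least_def by (metis obtain_subset_with_card_n subset_trans)

lemma infinite_iff_at_least: "infinite S \<longleftrightarrow> (\<forall>n. at_least n S)"
proof
  assume "infinite S"
  then show "\<forall>n. at_least n S"
    unfolding at_least_def by (metis infinite_arbitrarily_large)
next
  assume *: "\<forall>n. at_least n S"
  show "infinite S"
  proof
    assume "finite S"
    moreover obtain T where "T \<subseteq> S" "card T = Suc (card S)"
      using * unfolding at_least_def by metis
    ultimately show False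
      by (metis card_mono Suc_n_not_le_n)
  qed
qed

lemma at_least_bij_betw:
  assumes "bij_betw f B A" "at_least n A"
  shows "at_least n B"
proof -
  obtain T where T: "T \<subseteq> A" "finite T" "card T = n"
    using assms(2) unfolding at_least_def by auto
  have bij: "bij_betw (inv_into B f) A B"
    using assms(1) by (rule bij_betw_inv_into)
  then have "inj_on (inv_into B f) T"
    using T(1) by (auto simp: bij_betw_def intro: inj_on_subset)
  then have "card (inv_into B f ` T) = n"
    using T by (simp add: card_image)
  moreover have "inv_into B f ` T \<subseteq> B"
    using bij T(1) by (auto simp: bij_betw_def)
  ultimately show ?thesis
    unfolding at_least_def using T(2) by blast
qed

lemma cluster_mono: "E \<subseteq> E' \<Longrightarrow> A \<subseteq> A' \<Longrightarrow> cluster E A \<subseteq> cluster E' A'"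
  unfolding cluster_def by (intro Image_mono rtrancl_mono) auto

lemma cluster_superset: "A \<subseteq> cluster E A"
  unfolding cluster_def by auto

lemma cluster_step: "u \<in> cluster E A \<Longrightarrow> {u, v} \<in> E \<Longrightarrow> v \<in> cluster E A"
  unfolding cluster_def by (auto intro: rtrancl_into_rtrancl)

lemma cluster_least:
  assumes "A \<subseteq> S" "\<And>u v. u \<in> S \<Longrightarrow> {u, v} \<in> E \<Longrightarrow> v \<in> S"
  shows "cluster E A \<subseteq> S"
proof
  fix v assume "v \<in> cluster E A"
  then obtain a where "a \<in> A" "(a, v) \<in> {(u, v). {u, v} \<in> E}\<^sup>*"
    unfolding cluster_def by auto
  from this(2) show "v \<in> S"
    by induction (use assms \<open>a \<in> A\<close> in auto)
qed

lemma cluster_closed: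
  assumes "\<And>x y. x \<in> A \<Longrightarrow> {x, y} \<in> E \<Longrightarrow> y \<in> A"
  shows "cluster E A = A"
  using cluster_least[of A A E] cluster_superset[of A E] assms by blast

text \<open>The deterministic exploration step. Both sides contain \<open>A\<close> and
  \<open>y\<close> and are closed under \<open>E\<close>; the extra edge has both endpoints in
  \<open>insert y A\<close>, so it leads nowhere new.\<close>

lemma cluster_insert_edge:
  assumes "x \<in> A"
  shows "cluster (insert {x, y} E) A = cluster E (insert y A)"
proof
  show "cluster (insert {x, y} E) A \<subseteq> cluster E (insert y A)"
  proof (rule cluster_least)
    show "A \<subseteq> cluster E (insert y A)"
      using cluster_superset[of "insert y A" E] by auto
    fix u v assume "u \<in> cluster E (insert y A)" "{u, v} \<in> insert {x, y} E"
    then show "v \<in> cluster E (insert y A)"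
      using cluster_superset[of "insert y A" E] cluster_step[of u E "insert y A" v] assms
      by (auto simp: doubleton_eq_iff)
  qed
  show "cluster E (insert y A) \<subseteq> cluster (insert {x, y} E) A"
  proof (rule cluster_least)
    show "insert y A \<subseteq> cluster (insert {x, y} E) A"
      using cluster_superset[of A "insert {x, y} E"] cluster_step[of x "insert {x, y} E" A y] assms
      by auto
    fix u v assume "u \<in> cluster (insert {x, y} E) A" "{u, v} \<in> E"
    then show "v \<in> cluster (insert {x, y} E) A"
      using cluster_step[of u "insert {x, y} E" A v] by auto
  qed
qed

text \<open>Each vertex of a cluster is reached along finitely many edges, so finitely many edges
  suffice for \<open>n\<close> vertices. This yields both the measurability of the cluster events
  and their approximation by finite edge sets.\<close>

lemma at_least_cluster_finite_edges:
  assumes "at_least n (cluster E A)"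
  obtains F where "F \<subseteq> E" "finite F" "at_least n (cluster F A)"
proof -
  let ?U = "\<Union>F\<in>{F. F \<subseteq> E \<and> finite F}. cluster F A"
  have "cluster E A \<subseteq> ?U"
  proof (rule cluster_least)
    show "A \<subseteq> ?U"
      using cluster_superset[of A "{}"] by blast
    fix u v assume "u \<in> ?U" "{u, v} \<in> E"
    then obtain F where F: "F \<subseteq> E" "finite F" "u \<in> cluster F A" by auto
    then have "v \<in> cluster (insert {u, v} F) A"
      using cluster_step[of u "insert {u, v} F" A v] cluster_mono[of F "insert {u, v} F" A A] by auto
    moreover have "insert {u, v} F \<in> {F. F \<subseteq> E \<and> finite F}"
      using F \<open>{u, v} \<in> E\<close> by simp
    ultimately show "v \<in> ?U"
      by (rule UN_I[rotated])
  qed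
  moreover obtain T where T: "T \<subseteq> cluster E A" "finite T" "card T = n"
    using assms unfolding at_least_def by auto
  ultimately have "\<forall>t\<in>T. \<exists>F. F \<subseteq> E \<and> finite F \<and> t \<in> cluster F A" by blast
  then obtain G where G: "\<And>t. t \<in> T \<Longrightarrow> G t \<subseteq> E \<and> finite (G t) \<and> t \<in> cluster (G t) A"
    by metis
  have "t \<in> cluster (\<Union>(G ` T)) A" if "t \<in> T" for t
    using G[OF that] cluster_mono[of "G t" "\<Union>(G ` T)" A A] that by blast
  then have "at_least n (cluster (\<Union>(G ` T)) A)"
    unfolding at_least_def using T by blast
  moreover have "\<Union>(G ` T) \<subseteq> E" "finite (\<Union>(G ` T))"
    using G T(2) by auto
  ultimately show ?thesis by (intro that)
qed

section \<open>Bernoulli percolation on a countable edge set\<close>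

definition bernoulli_product :: "'e set \<Rightarrow> ('e \<Rightarrow> real) \<Rightarrow> ('e \<Rightarrow> bool) measure" where
  "bernoulli_product I q = (\<Pi>\<^sub>M e\<in>I. measure_pmf (bernoulli_pmf (q e)))"

text \<open>The edges \<open>J\<close> open to exploration are kept apart from the index set
  \<open>I\<close> of the measure, so that \<open>J\<close> can shrink on a fixed probability
  space.\<close>

definition large_cluster_event ::
    "'v set set \<Rightarrow> ('v set \<Rightarrow> real) \<Rightarrow> nat \<Rightarrow> 'v set set \<Rightarrow> 'v set \<Rightarrow> ('v set \<Rightarrow> bool) set" where
  "large_cluster_event I q n J A =
     {\<omega> \<in> space (bernoulli_product I q). at_least n (cluster {e \<in> J. \<omega> e} A)}"

definition large_cluster_prob ::
    "'v set set \<Rightarrow> ('v set \<Rightarrow> real) \<Rightarrow> nat \<Rightarrow> 'v set set \<Rightarrow> 'v set \<Rightarrow> real" where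
  "large_cluster_prob I q n J A = measure (bernoulli_product I q) (large_cluster_event I q n J A)"

lemma prob_space_bernoulli_product: "prob_space (bernoulli_product I q)"
  unfolding bernoulli_product_def by (intro prob_space_PiM prob_space_measure_pmf)

lemma sets_edge_open:
  assumes "e \<in> I"
  shows "{\<omega> \<in> space (bernoulli_product I q). \<omega> e} \<in> sets (bernoulli_product I q)"
proof -
  have "(\<lambda>\<omega>. \<omega> e) \<in> measurable (bernoulli_product I q) (measure_pmf (bernoulli_pmf (q e)))"
    unfolding bernoulli_product_def using assms by (rule measurable_component_singleton)
  then have "(\<lambda>\<omega>. \<omega> e) -` {True} \<inter> space (bernoulli_product I q) \<in> sets (bernoulli_product I q)"
    by (rule measurable_sets) simp
  also have "(\<lambda>\<omega>. \<omega> e) -` {True} \<inter> space (bernoulli_product I q)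
      = {\<omega> \<in> space (bernoulli_product I q). \<omega> e}"
    by auto
  finally show ?thesis .
qed

text \<open>The event is a countable union of cylinders: some finite \<open>F\<close> that already
  connects \<open>A\<close> to enough vertices is entirely open.\<close>

lemma sets_large_cluster_event:
  assumes "countable J" "J \<subseteq> I"
  shows "large_cluster_event I q n J A \<in> sets (bernoulli_product I q)"
proof -
  let ?M = "bernoulli_product I q"
  let ?C = "{F. finite F \<and> F \<subseteq> J} \<inter> {F. at_least n (cluster F A)}"
  have eq: "large_cluster_event I q n J A
      = (\<Union>F\<in>?C. {\<omega> \<in> space ?M. \<forall>e\<in>F. \<omega> e})" (is "_ = ?R")
  proof
    show "large_cluster_event I q n J A \<subseteq> ?R"
    proof
      fix \<omega> assume \<omega>: "\<omega> \<in> large_cluster_event I q n J A"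
      then obtain F where "F \<subseteq> {e \<in> J. \<omega> e}" "finite F" "at_least n (cluster F A)"
        unfolding large_cluster_event_def using at_least_cluster_finite_edges by blast
      then show "\<omega> \<in> ?R"
        using \<omega> unfolding large_cluster_event_def by blast
    qed
    show "?R \<subseteq> large_cluster_event I q n J A"
    proof
      fix \<omega> assume "\<omega> \<in> ?R"
      then obtain F where F: "F \<subseteq> J" "at_least n (cluster F A)" "\<omega> \<in> space ?M" "\<forall>e\<in>F. \<omega> e"
        by blast
      then have "cluster F A \<subseteq> cluster {e \<in> J. \<omega> e} A"
        by (intro cluster_mono) auto
      then show "\<omega> \<in> large_cluster_event I q n J A"
        using F at_least_mono unfolding large_cluster_event_def by blast
    qed
  qed
  have open_sets: "{\<omega> \<in> space ?M. \<forall>e\<in>F. \<omega> e} \<in> sets ?M" if "F \<in> ?C" for F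
    using that assms(2) by (intro sets.sets_Collect_finite_All sets_edge_open) auto
  show ?thesis
    unfolding eq using open_sets countable_Collect_finite_subset[OF assms(1)]
    by (intro sets.countable_UN'' countable_Int1)
qed

lemma large_cluster_prob_mono:
  assumes "countable I" "J' \<subseteq> I" "J \<subseteq> J'" "A \<subseteq> A'"
  shows "large_cluster_prob I q n J A \<le> large_cluster_prob I q n J' A'"
proof -
  interpret prob_space "bernoulli_product I q" by (rule prob_space_bernoulli_product)
  have "cluster {e \<in> J. \<omega> e} A \<subseteq> cluster {e \<in> J'. \<omega> e} A'" for \<omega> :: "'a set \<Rightarrow> bool"
    using assms by (intro cluster_mono) auto
  then have "large_cluster_event I q n J A \<subseteq> large_cluster_event I q n J' A'"
    unfolding large_cluster_event_def using at_least_mono by blast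
  then show ?thesis
    unfolding large_cluster_prob_def using assms
    by (intro finite_measure_mono sets_large_cluster_event) (auto intro: countable_subset)
qed

lemma large_cluster_prob_le_1: "large_cluster_prob I q n J A \<le> 1"
  unfolding large_cluster_prob_def by (rule prob_space.prob_le_1[OF prob_space_bernoulli_product])

lemma large_cluster_prob_eq_1:
  assumes "at_least n A"
  shows "large_cluster_prob I q n J A = 1"
proof -
  interpret prob_space "bernoulli_product I q" by (rule prob_space_bernoulli_product)
  have "large_cluster_event I q n J A = space (bernoulli_product I q)"
    unfolding large_cluster_event_def
    using at_least_mono[OF assms cluster_superset] by auto
  then show ?thesis
    unfolding large_cluster_prob_def by (simp add: prob_space)
qed

lemma large_cluster_prob_eq_0:
  assumes "\<not> at_least n A" "\<And>x y. x \<in> A \<Longrightarrow> {x, y} \<in> J \<Longrightarrow> y \<in> A"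
  shows "large_cluster_prob I q n J A = 0"
proof -
  have "cluster {e \<in> J. \<omega> e} A = A" for \<omega>
    using assms(2) by (intro cluster_closed) auto
  then show ?thesis
    unfolding large_cluster_prob_def large_cluster_event_def using assms(1) by simp
qed

text \<open>Independence: the cluster event looks only at edges of \<open>J\<close>, and
  \<open>e\<close> is not one of them. Splitting off the coordinate \<open>e\<close> turns the event
  into a rectangle.\<close>

lemma measure_edge_state_inter_large_cluster_event:
  assumes "countable I" "e \<in> I" "J \<subseteq> I" "e \<notin> J"
  shows "measure (bernoulli_product I q) {\<omega> \<in> large_cluster_event I q n J A. \<omega> e = b}
    = pmf (bernoulli_pmf (q e)) b * large_cluster_prob I q n J A"
proof -
  define I' where "I' = I - {e}"
  let ?Me = "measure_pmf (bernoulli_pmf (q e))"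
  let ?M = "bernoulli_product I q" and ?M' = "bernoulli_product I' q"
  let ?upd = "\<lambda>(x, X). X(e := x)"
  let ?S = "large_cluster_event I q n J A" and ?S' = "large_cluster_event I' q n J A"
  have I: "I = insert e I'" "e \<notin> I'"
    using assms(2) by (auto simp: I'_def)
  have J: "J \<subseteq> I'"
    using assms by (auto simp: I'_def)
  interpret M': prob_space ?M' by (rule prob_space_bernoulli_product)
  have distr: "distr (?Me \<Otimes>\<^sub>M ?M') ?M ?upd = ?M"
    unfolding bernoulli_product_def I(1)
    by (rule distr_pair_PiM_eq_PiM) (auto intro: prob_space_measure_pmf)
  have upd: "?upd \<in> measurable (?Me \<Otimes>\<^sub>M ?M') ?M"
    unfolding bernoulli_product_def I(1) by measurable
  have S: "?S \<in> sets ?M" and S': "?S' \<in> sets ?M'"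
    using assms J by (auto intro!: sets_large_cluster_event intro: countable_subset)
  \<comment> \<open>The choice \<open>B = UNIV\<close> will identify the probabilities of
    \<open>?S\<close> and \<open>?S'\<close>, and \<open>B = {b}\<close> will give the
    claim.\<close>
  have fibre: "measure ?M {\<omega> \<in> ?S. \<omega> e \<in> B} = measure ?Me B * measure ?M' ?S'" for B
  proof -
    have meas: "{\<omega> \<in> ?S. \<omega> e \<in> B} \<in> sets ?M"
    proof -
      have "(\<lambda>\<omega>. \<omega> e) \<in> measurable ?M ?Me"
        unfolding bernoulli_product_def using assms(2) by (rule measurable_component_singleton)
      then have "(\<lambda>\<omega>. \<omega> e) -` B \<inter> space ?M \<in> sets ?M"
        by (rule measurable_sets) simp
      then have "?S \<inter> ((\<lambda>\<omega>. \<omega> e) -` B \<inter> space ?M) \<in> sets ?M"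
        using S by (rule sets.Int[rotated])
      also have "?S \<inter> ((\<lambda>\<omega>. \<omega> e) -` B \<inter> space ?M) = {\<omega> \<in> ?S. \<omega> e \<in> B}"
        by (auto simp: large_cluster_event_def)
      finally show ?thesis .
    qed
    have cong: "{f \<in> J. (X(e := x)) f} = {f \<in> J. X f}" for x X
      using assms(4) by auto
    have sp: "X(e := x) \<in> space ?M" if "X \<in> space ?M'" for x X
      using that by (auto simp: bernoulli_product_def space_PiM I(1) PiE_def extensional_def)
    have "?upd -` {\<omega> \<in> ?S. \<omega> e \<in> B} \<inter> space (?Me \<Otimes>\<^sub>M ?M') = B \<times> ?S'"
      using sp by (auto simp: large_cluster_event_def space_pair_measure cong simp del: fun_upd_apply)
        simp_all
    then have "measure ?M {\<omega> \<in> ?S. \<omega> e \<in> B} = measure (?Me \<Otimes>\<^sub>M ?M') (B \<times> ?S')"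
      using measure_distr[OF upd meas] by (simp add: distr)
    also have "\<dots> = measure ?Me B * measure ?M' ?S'"
      using S'
      by (simp add: measure_def M'.emeasure_pair_measure_Times enn2real_mult)
    finally show ?thesis .
  qed
  have "measure ?M ?S = measure ?M' ?S'"
    using fibre[of UNIV] by simp
  moreover have "measure ?M {\<omega> \<in> ?S. \<omega> e = b} = pmf (bernoulli_pmf (q e)) b * measure ?M' ?S'"
    using fibre[of "{b}"] by (simp add: pmf.rep_eq)
  ultimately show ?thesis
    by (simp add: large_cluster_prob_def)
qed

text \<open>Condition on the state of \<open>{x, y}\<close>: if open, \<open>y\<close> joins the
  explored set; if closed, the edge disappears. What remains depends on \<open>J\<close> only, hence
  is independent of that state.\<close>

lemma large_cluster_prob_insert:
  assumes "countable I" "{x, y} \<in> I" "J \<subseteq> I" "{x, y} \<notin> J" "x \<in> A" "q {x, y} \<in> {0..1}"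
  shows "large_cluster_prob I q n (insert {x, y} J) A
    = q {x, y} * large_cluster_prob I q n J (insert y A)
      + (1 - q {x, y}) * large_cluster_prob I q n J A"
proof -
  let ?M = "bernoulli_product I q" and ?e = "{x, y}"
  interpret prob_space ?M by (rule prob_space_bernoulli_product)
  let ?S1 = "{\<omega> \<in> large_cluster_event I q n J (insert y A). \<omega> ?e = True}"
  let ?S0 = "{\<omega> \<in> large_cluster_event I q n J A. \<omega> ?e = False}"
  have sets: "large_cluster_event I q n J B \<in> sets ?M" for B
    using assms by (auto intro!: sets_large_cluster_event intro: countable_subset)
  have "?S1 = large_cluster_event I q n J (insert y A) \<inter> {\<omega> \<in> space ?M. \<omega> ?e}"
    "?S0 = large_cluster_event I q n J A - {\<omega> \<in> space ?M. \<omega> ?e}"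
    by (auto simp: large_cluster_event_def)
  then have S: "?S1 \<in> sets ?M" "?S0 \<in> sets ?M"
    using sets sets_edge_open[OF assms(2)] by auto
  have "{f \<in> insert ?e J. \<omega> f} = (if \<omega> ?e then insert ?e {f \<in> J. \<omega> f} else {f \<in> J. \<omega> f})" for \<omega>
    by auto
  then have "large_cluster_event I q n (insert ?e J) A = ?S1 \<union> ?S0"
    unfolding large_cluster_event_def
    by (auto simp: cluster_insert_edge[OF assms(5)] split: if_splits)
  moreover have "measure ?M (?S1 \<union> ?S0) = measure ?M ?S1 + measure ?M ?S0"
    using S by (intro finite_measure_Union) auto
  moreover have "measure ?M ?S1 = q ?e * large_cluster_prob I q n J (insert y A)"
    using measure_edge_state_inter_large_cluster_event[OF assms(1-4), where b = True] assms(6)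
    by simp
  moreover have "measure ?M ?S0 = (1 - q ?e) * large_cluster_prob I q n J A"
    using measure_edge_state_inter_large_cluster_event[OF assms(1-4), where b = False] assms(6)
    by simp
  ultimately show ?thesis
    by (simp only: large_cluster_prob_def[of I q n "insert ?e J"])
qed

text \<open>Continuity from below along an exhaustion of \<open>I\<close> by finite sets: the
  finitely many edges that witness a large cluster all lie in a single member of the
  exhaustion.\<close>

lemma large_cluster_prob_finite_edges:
  assumes "countable I" "\<And>F. finite F \<Longrightarrow> F \<subseteq> I \<Longrightarrow> large_cluster_prob I q n F A \<le> c"
  shows "large_cluster_prob I q n I A \<le> c"
proof -
  let ?M = "bernoulli_product I q"
  interpret prob_space ?M by (rule prob_space_bernoulli_product)
  obtain F where F: "\<And>i. F i \<subseteq> I" "\<And>i. F i \<subseteq> F (Suc i)" "\<And>i. finite (F i)" "(\<Union>i. F i) = I"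
    using finite_sequence_to_countable_set[OF assms(1)] by metis
  have mono: "F i \<subseteq> F j" if "i \<le> j" for i j
    using lift_Suc_mono_le[of F i j] F(2) that by auto
  let ?S = "\<lambda>i. large_cluster_event I q n (F i) A"
  have "?S i \<subseteq> ?S j" if "i \<le> j" for i j
  proof -
    have "cluster {e \<in> F i. \<omega> e} A \<subseteq> cluster {e \<in> F j. \<omega> e} A" for \<omega>
      using mono[OF that] by (intro cluster_mono) auto
    then show ?thesis
      unfolding large_cluster_event_def using at_least_mono by blast
  qed
  then have "incseq ?S"
    by (auto simp: incseq_def)
  moreover have "range ?S \<subseteq> sets ?M"
    using F by (auto intro!: sets_large_cluster_event countable_finite)
  ultimately have lim: "(\<lambda>i. measure ?M (?S i)) \<longlonglongrightarrow> measure ?M (\<Union>i. ?S i)"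
    by (intro finite_Lim_measure_incseq)
  have "(\<Union>i. ?S i) = large_cluster_event I q n I A"
  proof
    show "large_cluster_event I q n I A \<subseteq> (\<Union>i. ?S i)"
    proof
      fix \<omega> assume \<omega>: "\<omega> \<in> large_cluster_event I q n I A"
      then obtain G where G: "G \<subseteq> {e \<in> I. \<omega> e}" "finite G" "at_least n (cluster G A)"
        unfolding large_cluster_event_def using at_least_cluster_finite_edges by blast
      have "\<exists>i. G \<subseteq> F i"
      proof -
        have "\<forall>g\<in>G. \<exists>i. g \<in> F i" using G(1) F(4) by blast
        then obtain k where k: "\<And>g. g \<in> G \<Longrightarrow> g \<in> F (k g)" by metis
        have "g \<in> F (Max (k ` G))" if "g \<in> G" for g
          using k[OF that] mono[of "k g" "Max (k ` G)"] G(2) that by auto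
        then show ?thesis by blast
      qed
      then obtain i where "G \<subseteq> F i" ..
      then have "cluster G A \<subseteq> cluster {e \<in> F i. \<omega> e} A"
        using G(1) by (intro cluster_mono) auto
      then have "\<omega> \<in> ?S i"
        using \<omega> G(3) at_least_mono unfolding large_cluster_event_def by blast
      then show "\<omega> \<in> (\<Union>i. ?S i)" by blast
    qed
    have "cluster {e \<in> F i. \<omega> e} A \<subseteq> cluster {e \<in> I. \<omega> e} A" for i \<omega>
      using F(1) by (intro cluster_mono) auto
    then show "(\<Union>i. ?S i) \<subseteq> large_cluster_event I q n I A"
      unfolding large_cluster_event_def using at_least_mono by blast
  qed
  then have "(\<lambda>i. large_cluster_prob I q n (F i) A) \<longlonglongrightarrow> large_cluster_prob I q n I A"
    using lim by (simp add: large_cluster_prob_def)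
  then show ?thesis
    by (rule LIMSEQ_le_const2) (use assms(2) F in auto)
qed

text \<open>Continuity from above: the events decrease in \<open>n\<close>, and a cluster is
  infinite when it has at least \<open>n\<close> vertices for every \<open>n\<close>.\<close>

lemma large_cluster_prob_tendsto:
  assumes "countable I"
  shows "(\<lambda>n. large_cluster_prob I q n I A) \<longlonglongrightarrow>
    measure (bernoulli_product I q)
      {\<omega> \<in> space (bernoulli_product I q). infinite (cluster {e \<in> I. \<omega> e} A)}"
proof -
  let ?M = "bernoulli_product I q"
  interpret prob_space ?M by (rule prob_space_bernoulli_product)
  have "decseq (\<lambda>n. large_cluster_event I q n I A)"
    using at_least_antimono by (auto simp: decseq_def large_cluster_event_def)
  moreover have "range (\<lambda>n. large_cluster_event I q n I A) \<subseteq> sets ?M"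
    using assms by (auto intro: sets_large_cluster_event)
  ultimately have "(\<lambda>n. measure ?M (large_cluster_event I q n I A)) \<longlonglongrightarrow>
      measure ?M (\<Inter>n. large_cluster_event I q n I A)"
    by (intro finite_Lim_measure_decseq)
  also have "(\<Inter>n. large_cluster_event I q n I A)
      = {\<omega> \<in> space ?M. infinite (cluster {e \<in> I. \<omega> e} A)}"
    unfolding large_cluster_event_def infinite_iff_at_least by auto
  finally show ?thesis
    by (simp add: large_cluster_prob_def)
qed

section \<open>Comparison along a projection\<close>

text \<open>In \<open>lift\<close>, \<open>W\<close> consists of the far ends of lifts of
  \<open>{\<pi> u, y}\<close> at \<open>u\<close>. The product is the probability that all these
  lifts are closed, and it has to match the probability that the projected edge is closed.
  \<open>W \<subseteq> V\<close> lets the exploration continue from the new vertices.\<close>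

locale percolation_projection =
  fixes E :: "'a set set" and q :: "'a set \<Rightarrow> real"
    and H :: "'b set set" and r :: "'b set \<Rightarrow> real"
    and V :: "'b set" and \<pi> :: "'b \<Rightarrow> 'a"
  assumes countable_E: "countable E" and countable_H: "countable H"
    and q: "e \<in> E \<Longrightarrow> q e \<in> {0..1}" and r: "h \<in> H \<Longrightarrow> r h \<in> {0..1}"
    and lift: "u \<in> V \<Longrightarrow> {\<pi> u, y} \<in> E \<Longrightarrow>
      \<exists>W. finite W \<and> W \<subseteq> V \<and> (\<forall>w\<in>W. {u, w} \<in> H \<and> \<pi> w = y) \<and>
        (\<Prod>w\<in>W. 1 - r {u, w}) = 1 - q {\<pi> u, y}"
begin

text \<open>Reveal the lifts at \<open>u\<close> one by one. With \<open>P\<close> the probability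
  that all are closed, the bound is \<open>(1 - P) * c + P * c0\<close>: \<open>c\<close> applies as
  soon as one lift is open, \<open>c0\<close> when none is.\<close>

lemma lift_edges_prob:
  assumes "finite W" "u \<in> B" "J \<subseteq> H" and W: "\<And>w. w \<in> W \<Longrightarrow> {u, w} \<in> H - J"
    and c: "\<And>w. w \<in> W \<Longrightarrow> c \<le> large_cluster_prob H r n J (insert w B)"
    and c0: "c0 \<le> large_cluster_prob H r n J B"
  shows "c + (\<Prod>w\<in>W. 1 - r {u, w}) * (c0 - c)
    \<le> large_cluster_prob H r n (J \<union> (\<lambda>w. {u, w}) ` W) B"
  using assms(1) W c
proof (induction W)
  case empty
  then show ?case using c0 by simp
next
  case (insert w W)
  let ?J = "J \<union> (\<lambda>w. {u, w}) ` W" and ?P = "\<Prod>w\<in>W. 1 - r {u, w}"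
  have J: "?J \<subseteq> H" and h: "{u, w} \<in> H" "{u, w} \<notin> ?J"
    using insert assms(3) by (auto simp: doubleton_eq_iff)
  have rh: "r {u, w} \<in> {0..1}" using r h by auto
  have "c \<le> large_cluster_prob H r n J (insert w B)"
    using insert by auto
  also have "\<dots> \<le> large_cluster_prob H r n ?J (insert w B)"
    by (rule large_cluster_prob_mono[OF countable_H J]) auto
  finally have 1: "c \<le> large_cluster_prob H r n ?J (insert w B)" .
  have 2: "c + ?P * (c0 - c) \<le> large_cluster_prob H r n ?J B"
    using insert by auto
  have "c + (\<Prod>w\<in>insert w W. 1 - r {u, w}) * (c0 - c)
      = r {u, w} * c + (1 - r {u, w}) * (c + ?P * (c0 - c))"
    using insert(1,2) by (simp add: algebra_simps)
  also have "\<dots> \<le> r {u, w} * large_cluster_prob H r n ?J (insert w B)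
      + (1 - r {u, w}) * large_cluster_prob H r n ?J B"
    using 1 2 rh by (intro add_mono mult_left_mono) auto
  also have "\<dots> = large_cluster_prob H r n (insert {u, w} ?J) B"
    using large_cluster_prob_insert[of H u w ?J B r n] countable_H h J assms(2) rh by simp
  also have "insert {u, w} ?J = J \<union> (\<lambda>w. {u, w}) ` insert w W"
    by auto
  finally show ?case .
qed

text \<open>The bijection says that \<open>B\<close> holds exactly one lift of each explored vertex,
  so \<open>A\<close> and \<open>B\<close> are equally large. \<open>A\<close> and \<open>B\<close>
  are arbitrary in the induction because they grow while \<open>F\<close> loses an edge.\<close>

lemma large_cluster_prob_lift_finite:
  assumes "finite F" "F \<subseteq> E" "bij_betw \<pi> B A" "B \<subseteq> V"
  shows "large_cluster_prob E q n F A \<le> large_cluster_prob H r n {h \<in> H. \<pi> ` h \<in> F} B"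
  using assms
proof (induction F arbitrary: A B rule: finite_psubset_induct)
  case (psubset F)
  show ?case
  \<comment> \<open>If no edge of \<open>F\<close> leaves \<open>A\<close>, the cluster is
    \<open>A\<close> in every configuration, and the probability downstairs is 1 or 0 according to
    the size of \<open>A\<close>.\<close>
  proof (cases "\<forall>x\<in>A. \<forall>y. {x, y} \<in> F \<longrightarrow> y \<in> A")
    case True
    show ?thesis
    proof (cases "at_least n A")
      case True
      then have "at_least n B"
        using psubset.prems(2) at_least_bij_betw by blast
      then show ?thesis
        by (simp add: large_cluster_prob_eq_1 large_cluster_prob_le_1)
    next
      case False
      then have "large_cluster_prob E q n F A = 0"
        using True by (intro large_cluster_prob_eq_0) auto
      then show ?thesis
        by (simp add: large_cluster_prob_def)
    qed
  next
    case False
    then obtain x y where xy: "x \<in> A" "{x, y} \<in> F" "y \<notin> A" by blast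
    then obtain u where u: "u \<in> B" "\<pi> u = x"
      using psubset.prems(2) by (auto simp: bij_betw_def)
    have "{\<pi> u, y} \<in> E" "u \<in> V"
      using xy u psubset.prems by auto
    then obtain W where W: "finite W" "W \<subseteq> V" "\<And>w. w \<in> W \<Longrightarrow> {u, w} \<in> H \<and> \<pi> w = y"
        "(\<Prod>w\<in>W. 1 - r {u, w}) = 1 - q {x, y}"
      using lift[of u y] u(2) by blast
    define F1 where "F1 = F - {{x, y}}"
    define J where "J = {h \<in> H. \<pi> ` h \<in> F1}"
    have F1: "F1 \<subset> F" "F1 \<subseteq> E" "F = insert {x, y} F1" "{x, y} \<notin> F1"
      using xy psubset.prems by (auto simp: F1_def)
    define c where "c = large_cluster_prob E q n F1 (insert y A)"
    define c0 where "c0 = large_cluster_prob E q n F1 A"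
    have c: "c \<le> large_cluster_prob H r n J (insert w B)" if "w \<in> W" for w
    proof -
      \<comment> \<open>Since \<open>y \<notin> A\<close>, no point of \<open>B\<close> lies over
        \<open>y\<close>, so adding \<open>w\<close> keeps \<pi> injective.\<close>
      have "bij_betw \<pi> (insert w B) (insert y A)"
        using psubset.prems(2) W(3)[OF that] xy(3)
        by (auto simp: bij_betw_def)
      then show ?thesis
        unfolding c_def J_def using F1 W that psubset.prems by (intro psubset.IH) auto
    qed
    have c0: "c0 \<le> large_cluster_prob H r n J B"
      unfolding c0_def J_def using F1 psubset.prems by (intro psubset.IH) auto
    \<comment> \<open>These edges project to \<open>{x, y}\<close>, which was removed from
      \<open>F\<close>; so they are still unrevealed and independent of what \<open>J\<close>
      shows.\<close>
    have lifts: "{u, w} \<in> H - J" if "w \<in> W" for w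
      using W(3)[OF that] u(2) F1(4) by (auto simp: J_def)
    have "large_cluster_prob E q n F A = q {x, y} * c + (1 - q {x, y}) * c0"
      unfolding F1(3) c_def c0_def using xy F1 psubset.prems q
      by (intro large_cluster_prob_insert countable_E) auto
    also have "\<dots> = c + (\<Prod>w\<in>W. 1 - r {u, w}) * (c0 - c)"
      unfolding W(4) by (simp add: algebra_simps)
    also have "\<dots> \<le> large_cluster_prob H r n (J \<union> (\<lambda>w. {u, w}) ` W) B"
      by (rule lift_edges_prob[OF W(1) u(1) _ lifts c c0]) (auto simp: J_def)
    \<comment> \<open>Any further edges over \<open>{x, y}\<close> were ignored; allowing them can
      only enlarge the cluster.\<close>
    also have "\<dots> \<le> large_cluster_prob H r n {h \<in> H. \<pi> ` h \<in> F} B"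
      using W(3) u(2) F1(3)
      by (intro large_cluster_prob_mono countable_H) (auto simp: J_def)
    finally show ?thesis .
  qed
qed

text \<open>Start from \<open>A = {\<pi> u}\<close> and \<open>B = {u}\<close>, let the finite edge
  sets exhaust \<open>E\<close> for fixed \<open>n\<close>, and then let \<open>n\<close> tend to
  infinity.\<close>

theorem infinite_cluster_prob_lift:
  assumes "u \<in> V"
  shows "measure (bernoulli_product E q)
      {\<omega> \<in> space (bernoulli_product E q). infinite (cluster {e \<in> E. \<omega> e} {\<pi> u})}
    \<le> measure (bernoulli_product H r)
      {\<omega> \<in> space (bernoulli_product H r). infinite (cluster {h \<in> H. \<omega> h} {u})}"
proof (rule LIMSEQ_le[OF large_cluster_prob_tendsto[OF countable_E]
      large_cluster_prob_tendsto[OF countable_H]])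
  have "large_cluster_prob E q n E {\<pi> u} \<le> large_cluster_prob H r n H {u}" for n
  proof (rule large_cluster_prob_finite_edges[OF countable_E])
    fix F assume "finite F" "F \<subseteq> E"
    then have "large_cluster_prob E q n F {\<pi> u}
        \<le> large_cluster_prob H r n {h \<in> H. \<pi> ` h \<in> F} {u}"
      using assms by (intro large_cluster_prob_lift_finite) auto
    also have "\<dots> \<le> large_cluster_prob H r n H {u}"
      by (rule large_cluster_prob_mono[OF countable_H]) auto
    finally show "large_cluster_prob E q n F {\<pi> u} \<le> large_cluster_prob H r n H {u}" .
  qed
  then show "\<exists>N. \<forall>n\<ge>N. large_cluster_prob E q n E {\<pi> u} \<le> large_cluster_prob H r n H {u}"
    by blast
qed

end

section \<open>The integer lattice\<close>

lemma countable_lattice: "countable (lattice d)"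
proof -
  let ?f = "\<lambda>(g :: nat \<Rightarrow> int) i. if i \<in> {1..d} then g i else 0"
  have "countable (PiE {1..d} (\<lambda>_. UNIV :: int set))"
    by (rule countable_PiE) auto
  moreover have "lattice d \<subseteq> ?f ` PiE {1..d} (\<lambda>_. UNIV)"
  proof
    fix x assume "x \<in> lattice d"
    then have "x = ?f (restrict x {1..d})"
      by (auto simp: lattice_def fun_eq_iff)
    moreover have "restrict x {1..d} \<in> PiE {1..d} (\<lambda>_. UNIV)"
      by auto
    ultimately show "x \<in> ?f ` PiE {1..d} (\<lambda>_. UNIV)"
      by blast
  qed
  ultimately show ?thesis
    by (meson countable_image countable_subset)
qed

lemma lattice_upd: "x \<in> lattice d \<Longrightarrow> i \<in> {1..d} \<Longrightarrow> x(i := k) \<in> lattice d"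
  unfolding lattice_def by auto

text \<open>Either endpoint may serve as the base point, since exchanging the endpoints only flips
  the sign of the step.\<close>

lemma edge_along_iff:
  assumes "i \<in> {1..d}"
  shows "{u, v} \<in> edges_along d i \<longleftrightarrow>
    u \<in> lattice d \<and> (\<exists>s\<in>{1, -1}. v = u(i := u i + s))" (is "?l \<longleftrightarrow> ?r")
proof
  assume ?l
  then obtain x y where xy: "{u, v} = {x, y}" "x \<in> lattice d"
      "y = x(i := x i + 1) \<or> y = x(i := x i - 1)"
    unfolding edges_along_def by auto
  then have "y \<in> lattice d" using lattice_upd assms by blast
  moreover have "x = y(i := y i + 1) \<or> x = y(i := y i - 1)"
    using xy(3) by auto
  ultimately show ?r
    using xy by (auto simp: doubleton_eq_iff)
next
  assume ?r
  then show ?l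
    unfolding edges_along_def by auto
qed

lemma edges_subset_lattice:
  assumes "{u, v} \<in> edges d"
  shows "u \<in> lattice d" "v \<in> lattice d"
  using assms unfolding edges_def by (auto simp: edge_along_iff lattice_upd)

lemma countable_edges: "countable (edges d)"
proof -
  have "edges d \<subseteq> (\<lambda>(x, y). {x, y}) ` (lattice d \<times> lattice d)"
  proof
    fix e assume e: "e \<in> edges d"
    then obtain x y where "e = {x, y}"
      unfolding edges_def edges_along_def by auto
    then show "e \<in> (\<lambda>(x, y). {x, y}) ` (lattice d \<times> lattice d)"
      using e edges_subset_lattice by auto
  qed
  then show ?thesis
    using countable_lattice by (meson countable_SIGMA countable_image countable_subset)
qed

lemma origin_in_lattice: "origin \<in> lattice d"
  unfolding origin_def lattice_def by simp

lemma connected_by_open_iff: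
  "connected_by_open d \<omega> x y \<longleftrightarrow> y \<in> cluster {e \<in> edges d. \<omega> e} {x}"
proof -
  let ?R = "{(u, v). {u, v} \<in> {e \<in> edges d. \<omega> e}}"
  \<comment> \<open>Reindexes the steps of a path from \<open>(j - 1, j)\<close> with
    \<open>1 \<le> j \<le> n\<close> to \<open>(j, Suc j)\<close> with \<open>j < n\<close>, the
    form of \<open>relpow_fun_conv\<close>.\<close>
  have shift: "(\<forall>j\<in>{1..n}. P (z (j - 1)) (z j)) \<longleftrightarrow> (\<forall>j<n. P (z j) (z (Suc j)))"
    for n :: nat and z :: "nat \<Rightarrow> vertex" and P
  proof
    assume *: "\<forall>j\<in>{1..n}. P (z (j - 1)) (z j)"
    show "\<forall>j<n. P (z j) (z (Suc j))"
    proof (intro allI impI)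
      fix j assume "j < n"
      then show "P (z j) (z (Suc j))" using bspec[OF *, of "Suc j"] by simp
    qed
  next
    assume *: "\<forall>j<n. P (z j) (z (Suc j))"
    show "\<forall>j\<in>{1..n}. P (z (j - 1)) (z j)"
    proof
      fix j assume "j \<in> {1..n}"
      then show "P (z (j - 1)) (z j)" using *[rule_format, of "j - 1"] by auto
    qed
  qed
  have "connected_by_open d \<omega> x y \<longleftrightarrow>
      (\<exists>n z. z 0 = x \<and> z n = y \<and> (\<forall>j<n. (z j, z (Suc j)) \<in> ?R))"
    unfolding connected_by_open_def
    using shift[of _ "\<lambda>u v. {u, v} \<in> edges d \<and> \<omega> {u, v}"] by simp
  also have "\<dots> \<longleftrightarrow> (x, y) \<in> ?R\<^sup>*"
    by (simp add: rtrancl_power relpow_fun_conv)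
  finally show ?thesis
    by (simp add: cluster_def)
qed

lemma open_cluster_eq: "open_cluster d \<omega> = cluster {e \<in> edges d. \<omega> e} {origin}"
proof -
  have "cluster {e \<in> edges d. \<omega> e} {origin} \<subseteq> lattice d"
    using edges_subset_lattice origin_in_lattice by (intro cluster_least) auto
  then show ?thesis
    unfolding open_cluster_def connected_by_open_iff by auto
qed

lemma theta_eq:
  "theta d p = measure (bernoulli_product (edges d) (\<lambda>e. p (direction d e)))
    {\<omega> \<in> space (bernoulli_product (edges d) (\<lambda>e. p (direction d e))).
      infinite (cluster {e \<in> edges d. \<omega> e} {origin})}"
  unfolding theta_def percolation_def bernoulli_product_def open_cluster_eq ..

theorem proposition1:
  fixes d :: nat and p :: "nat \<Rightarrow> real" and p' :: real
  assumes "d \<ge> 1"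
    and "\<And>i. i \<in> {1..d + 1} \<Longrightarrow> 0 \<le> p i \<and> p i < 1"
    and "0 \<le> p'" and "p' < 1"
    and "1 - p' = (1 - p d) * (1 - p (d + 1))"
  shows "theta (d + 1) p \<ge> theta d (p(d := p'))"
proof -
  \<comment> \<open>Unit steps along coordinates \<open>d\<close> and \<open>d + 1\<close> both
    become unit steps along \<open>d\<close>; clearing coordinate \<open>d + 1\<close> puts the
    image of a lattice point into \<open>lattice d\<close>.\<close>
  define \<pi> :: "vertex \<Rightarrow> vertex" where "\<pi> x = x(d := x d + x (d + 1), d + 1 := 0)" for x
  \<comment> \<open>As a definite description, \<open>direction\<close> is controlled only on actual
    edges.\<close>
  have dir: "direction k e \<in> {1..k}" if "e \<in> edges k" for k e
    using that direction_eq unfolding edges_def by fastforce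
  have lift_edge: "{u, u(i := u i + s)} \<in> edges (d + 1) \<and> direction (d + 1) {u, u(i := u i + s)} = i
      \<and> u(i := u i + s) \<in> lattice (d + 1)"
    if "u \<in> lattice (d + 1)" "i \<in> {1..d + 1}" "s \<in> {1, -1}" for u i s
  proof -
    have "{u, u(i := u i + s)} \<in> edges_along (d + 1) i"
      using that edge_along_iff by blast
    then show ?thesis
      using that direction_eq lattice_upd unfolding edges_def by blast
  qed
  interpret percolation_projection "edges d" "\<lambda>e. (p(d := p')) (direction d e)"
    "edges (d + 1)" "\<lambda>h. p (direction (d + 1) h)" "lattice (d + 1)" \<pi>
  proof
    show "(p(d := p')) (direction d e) \<in> {0..1}" if "e \<in> edges d" for e
      using dir[OF that] assms(2)[of "direction d e"] assms(3,4) by auto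
    show "p (direction (d + 1) h) \<in> {0..1}" if "h \<in> edges (d + 1)" for h
      using dir[OF that] assms(2)[of "direction (d + 1) h"] by auto
    fix u y assume u: "u \<in> lattice (d + 1)" and "{\<pi> u, y} \<in> edges d"
    then obtain i where i: "i \<in> {1..d}" "{\<pi> u, y} \<in> edges_along d i"
      unfolding edges_def by auto
    then obtain s where s: "s \<in> {1, -1}" "y = (\<pi> u)(i := \<pi> u i + s)"
      using edge_along_iff by blast
    have dir_i: "direction d {\<pi> u, y} = i"
      using i by (rule direction_eq)
    let ?w = "\<lambda>j. u(j := u j + s)"
    \<comment> \<open>The directions of the lifts: the closing probabilities over \<open>D\<close>
      multiply to \<open>(1 - p d) * (1 - p (d + 1)) = 1 - p'\<close> if \<open>i = d\<close>, and
      to \<open>1 - p i\<close> otherwise.\<close>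
    define D where "D = (if i = d then {d, d + 1} else {i})"
    have D: "D \<subseteq> {1..d + 1}" "finite D"
      using i(1) by (auto simp: D_def)
    have edge: "{u, ?w j} \<in> edges (d + 1) \<and> direction (d + 1) {u, ?w j} = j \<and> ?w j \<in> lattice (d + 1)"
      if "j \<in> D" for j
      using lift_edge[OF u _ s(1)] D that by blast
    \<comment> \<open>As \<open>s\<close> is nonzero, different directions give different endpoints,
      so the product over endpoints becomes one over \<open>D\<close>.\<close>
    have "inj_on ?w D"
      using s(1) by (auto simp: inj_on_def fun_eq_iff)
    then have "(\<Prod>w\<in>?w ` D. 1 - p (direction (d + 1) {u, w})) = (\<Prod>j\<in>D. 1 - p j)"
      using edge by (simp add: prod.reindex)
    also have "\<dots> = 1 - (p(d := p')) (direction d {\<pi> u, y})"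
      unfolding dir_i using assms(5) by (auto simp: D_def)
    finally have "(\<Prod>w\<in>?w ` D. 1 - p (direction (d + 1) {u, w}))
        = 1 - (p(d := p')) (direction d {\<pi> u, y})" .
    moreover have "\<pi> (?w j) = y" if "j \<in> D" for j
      using that s(2) i(1) by (auto simp: D_def \<pi>_def fun_eq_iff split: if_splits)
    ultimately show "\<exists>W. finite W \<and> W \<subseteq> lattice (d + 1) \<and>
        (\<forall>w\<in>W. {u, w} \<in> edges (d + 1) \<and> \<pi> w = y) \<and>
        (\<Prod>w\<in>W. 1 - p (direction (d + 1) {u, w})) = 1 - (p(d := p')) (direction d {\<pi> u, y})"
      using edge D(2) by (intro exI[of _ "?w ` D"]) auto
  qed (rule countable_edges)+
  have "\<pi> origin = origin"
    by (auto simp: \<pi>_def origin_def)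
  then show ?thesis
    using infinite_cluster_prob_lift[OF origin_in_lattice] by (simp add: theta_eq)
qed

end
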